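(* Let $p,q,l\ge 1$ be integers, let $x=(x^1,\dots,x^p)\in\mathbb{R}^p$, $u=(u^1,\dots,u^q)^T$ with $u^i=u^i(x)$, and let $\Delta=(\Delta_1,\dots,\Delta_l)^T\in\mathcal{A}^l$. Let $\sigma=(\sigma_1,\dots,\sigma_q)^T\in\mathcal{B}^q$ be a symmetry and $\rho=(\rho_1,\dots,\rho_l)^T\in\mathcal{B}^l$ an adjoint symmetry of the system of differential equations $\Delta(u)=0$. Then $$ \sum_{k=1}^p\partial_k\left[\sum_{i=1}^l\sum_{j=1}^q\sum_{\alpha\ge 0}\ \sum_{\beta_k=0}^{\alpha_k-1}\Big((-\partial_1)^{\alpha_1}\cdots(-\partial_{k-1})^{\alpha_{k-1}}(-\partial_k)^{\beta_k}\Big(\rho_i\frac{\partial\Delta_i}{\partial u^j_\alpha}\Big)\Big)\Big(\partial_k^{\alpha_k-\beta_k-1}\partial_{k+1}^{\alpha_{k+1}}\cdots\partial_p^{\alpha_p}\sigma_j\Big)\right]=0 $$ is a conservation law of the system $\Delta(u)=0$, i.e. this total divergence relation holds for all solutions $u$ of $\Delta(u)=0$. Here $\alpha=(\alpha_1,\dots,\alpha_p)$ ranges over multi-indices of non-negative integers, an empty sum is zero, and an empty product of derivatives is the identity operator.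
   Context: Notation. $\partial_j=\partial/\partial x^j$ denotes (total) differentiation with respect to $x^j$. For a multi-index $\alpha=(\alpha_1,\dots,\alpha_p)$ of non-negative integers (written $\alpha\ge 0$), $D^\alpha=\partial_1^{\alpha_1}\cdots\partial_p^{\alpha_p}$, $(-D)^\alpha=(-\partial_1)^{\alpha_1}\cdots(-\partial_p)^{\alpha_p}$, and $u^i_\alpha=D^\alpha u^i$. $\mathcal{A}$ is the space of all functions $f(x,u,\dots,u^{(n)})$, $n\ge 0$, with $f$ smooth in the variables involved, where $u^{(n)}$ is the set of $n$-th order partial derivatives of $u$ with respect to $x$ (local, differential functions). $\mathcal{B}$ is the space of smooth functions of $x$, $u$ and derivatives of $u$ to some finite order where nonlocal dependence on $u$ is also allowed (for example $x^l\int_0^{x^k}\partial_j u^i\,dx^k$, $j\neq k$); thus an element of $\mathcal{B}$ assigns to a smooth $u$ a smooth function of $x$. $\mathcal{A}^r,\mathcal{B}^r$ denote $r$-component column vectors with entries in $\mathcal{A}$, $\mathcal{B}$. The Gateaux operator of $\Delta\in\mathcal{A}^l$ is the $l\times q$ matrix differential operator $\Delta'=\Delta'(u)$ with $(i,j)$ entry $\sum_{\alpha\ge0}\frac{\partial\Delta_i}{\partial u^j_\alpha}D^\alpha$; equivalently $\Delta'(u)\sigma=\frac{\partial}{\partial\varepsilon}\big|_{\varepsilon=0}\Delta(u+\varepsilon\sigma)$. Its adjoint $(\Delta')^*$ is the $q\times l$ matrix differential operator whose $(j,i)$ entry is $\sum_{\alpha\ge0}(-D)^\alpha\frac{\partial\Delta_i}{\partial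 u^j_\alpha}$, i.e. $((\Delta')^*\rho)_j=\sum_{i=1}^l\sum_{\alpha\ge0}(-D)^\alpha\big(\frac{\partial\Delta_i}{\partial u^j_\alpha}\rho_i\big)$. $\sigma\in\mathcal{B}^q$ is a symmetry of $\Delta(u)=0$ if $\Delta'(u)\sigma(u)=0$ whenever $u$ solves $\Delta(u)=0$. $\rho\in\mathcal{B}^l$ is an adjoint symmetry of $\Delta(u)=0$ if $(\Delta')^*(u)\rho(u)=0$ whenever $u$ solves $\Delta(u)=0$. A conservation law of $\Delta(u)=0$ is a relation $\sum_{i=1}^p\partial_iP_i=0$, with $P=(P_1,\dots,P_p)^T\in\mathcal{B}^p$, holding for all solutions $u$ of $\Delta(u)=0$. *)

theory Defs
  imports "HOL-Analysis.Analysis" "HOL-Library.Groups_Big_Fun"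
begin

text \<open>
  The independent variables are indexed by a nonempty finite linearly ordered type \<open>'p\<close>
  (the order is that of \<open>1, \<dots>, p\<close>), the dependent variables by \<open>'q\<close> and the equations of
  the system by \<open>'l\<close>. All functions \<open>u\<close> are defined on the whole of \<open>real ^ 'p\<close>.
\<close>

type_synonym 'p multi_index = "'p \<Rightarrow> nat"
type_synonym 'p scalar_fun = "(real, 'p) vec \<Rightarrow> real"
type_synonym ('p, 'q) vector_fun = "(real, 'p) vec \<Rightarrow> (real, 'q) vec"
type_synonym ('p, 'q) nonlocal_op = "('p, 'q) vector_fun \<Rightarrow> 'p scalar_fun"

definition pd :: "'p::finite \<Rightarrow> 'p scalar_fun \<Rightarrow> 'p scalar_fun" where
  "pd k f x = deriv (\<lambda>t. f (x + t *\<^sub>R axis k 1)) 0"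

definition neg_pd :: "'p::finite \<Rightarrow> 'p scalar_fun \<Rightarrow> 'p scalar_fun" where
  "neg_pd k f x = - pd k f x"

text \<open>
  \<open>Dop K \<alpha>\<close> is the composition of the operators \<open>pd k ^^ \<alpha> k\<close> for \<open>k \<in> K\<close>, the operator of
  the least index being outermost (applied last); \<open>neg_Dop\<close> is the same with \<open>- pd k\<close>. The
  full operators $D^\alpha$ and $(-D)^\alpha$ are obtained for \<open>K = UNIV\<close>.
\<close>

definition Dop :: "'p::{finite,linorder} set \<Rightarrow> 'p multi_index \<Rightarrow>
    'p scalar_fun \<Rightarrow> 'p scalar_fun" where
  "Dop K \<alpha> f = foldr (\<lambda>k. pd k ^^ \<alpha> k) (sorted_list_of_set K) f"

definition neg_Dop :: "'p::{finite,linorder} set \<Rightarrow> 'p multi_index \<Rightarrow>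
    'p scalar_fun \<Rightarrow> 'p scalar_fun" where
  "neg_Dop K \<alpha> f = foldr (\<lambda>k. neg_pd k ^^ \<alpha> k) (sorted_list_of_set K) f"

text \<open>\<open>C\<^sup>\<infinity>\<close>: all iterated partial derivatives are (Frechet) differentiable everywhere.\<close>

definition smooth :: "'p::finite scalar_fun \<Rightarrow> bool" where
  "smooth f \<longleftrightarrow> (\<forall>ks. foldr pd ks f differentiable_on UNIV)"

definition smooth_vec :: "('p::finite, 'q::finite) vector_fun \<Rightarrow> bool" where
  "smooth_vec u \<longleftrightarrow> (\<forall>j. smooth (\<lambda>x. u x $ j))"

text \<open>
  Coordinates of the infinite jet space: \<open>Indep k\<close> stands for $x^k$ and \<open>Dep j \<alpha>\<close> for
  $u^j_\alpha$. A point of the jet space assigns a real number to every coordinate.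
\<close>

datatype ('p, 'q) jet_coord = Indep 'p | Dep 'q "'p multi_index"

type_synonym ('p, 'q) jet = "('p, 'q) jet_coord \<Rightarrow> real"
type_synonym ('p, 'q) jet_fun = "('p, 'q) jet \<Rightarrow> real"

definition jet_pd :: "('p, 'q) jet_coord \<Rightarrow> ('p, 'q) jet_fun \<Rightarrow> ('p, 'q) jet_fun" where
  "jet_pd v f z = deriv (\<lambda>t. f (z(v := t))) (z v)"

definition order_le :: "nat \<Rightarrow> ('p::finite, 'q::finite) jet_fun \<Rightarrow> bool" where
  "order_le n f \<longleftrightarrow> (\<forall>z w. (\<forall>k. z (Indep k) = w (Indep k)) \<longrightarrow>
     (\<forall>j \<alpha>. (\<Sum>k\<in>UNIV. \<alpha> k) \<le> n \<longrightarrow> z (Dep j \<alpha>) = w (Dep j \<alpha>)) \<longrightarrow> f z = f w)"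

text \<open>
  Continuity refers to the product topology. For a function of finite order, i.e. of finitely
  many coordinates, it is ordinary continuity in these coordinates, so that \<open>jet_smooth\<close> says
  that all iterated partial derivatives exist and are continuous.
\<close>

definition jet_smooth :: "('p, 'q) jet_fun \<Rightarrow> bool" where
  "jet_smooth f \<longleftrightarrow> (\<forall>vs. continuous_on UNIV (foldr jet_pd vs f) \<and>
     (\<forall>v z. (\<lambda>t. foldr jet_pd vs f (z(v := t))) differentiable at (z v)))"

text \<open>The space $\mathcal{A}$ of local (differential) functions.\<close>

definition local_funs :: "('p::finite, 'q::finite) jet_fun set" where
  "local_funs = {f. (\<exists>n. order_le n f) \<and> jet_smooth f}"

text \<open>
  The space $\mathcal{B}$: possibly nonlocal operators taking a smooth \<open>u\<close> to a smooth function of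
  \<open>x\<close>; their values on nonsmooth \<open>u\<close> are irrelevant.
\<close>

definition nonlocal_funs :: "('p::finite, 'q::finite) nonlocal_op set" where
  "nonlocal_funs = {\<sigma>. \<forall>u. smooth_vec u \<longrightarrow> smooth (\<sigma> u)}"

definition prolong :: "('p::{finite,linorder}, 'q::finite) vector_fun \<Rightarrow>
    (real, 'p) vec \<Rightarrow> ('p, 'q) jet" where
  "prolong u x c = (case c of Indep k \<Rightarrow> x $ k | Dep j \<alpha> \<Rightarrow> Dop UNIV \<alpha> (\<lambda>y. u y $ j) x)"

definition solution ::
    "('l \<Rightarrow> ('p::{finite,linorder}, 'q::finite) jet_fun) \<Rightarrow> ('p, 'q) vector_fun \<Rightarrow> bool" where
  "solution \<Delta> u \<longleftrightarrow> smooth_vec u \<and> (\<forall>i x. \<Delta> i (prolong u x) = 0)"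

text \<open>
  \<open>Sum_any\<close> sums over the support of its argument. The support is finite in the sums over all
  multi-indices below, since \<open>jet_pd (Dep j \<alpha>) (\<Delta> i)\<close> vanishes identically when the order of
  \<open>\<alpha>\<close> exceeds that of \<open>\<Delta> i\<close>.
\<close>

definition gateaux :: "('l \<Rightarrow> ('p::{finite,linorder}, 'q::finite) jet_fun) \<Rightarrow>
    ('p, 'q) vector_fun \<Rightarrow> ('q \<Rightarrow> 'p scalar_fun) \<Rightarrow> 'l \<Rightarrow> 'p scalar_fun" where
  "gateaux \<Delta> u s i x =
     (\<Sum>j\<in>UNIV. Sum_any (\<lambda>\<alpha>. jet_pd (Dep j \<alpha>) (\<Delta> i) (prolong u x) * Dop UNIV \<alpha> (s j) x))"

definition gateaux_adjoint :: "('l::finite \<Rightarrow> ('p::{finite,linorder}, 'q::finite) jet_fun) \<Rightarrow>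
    ('p, 'q) vector_fun \<Rightarrow> ('l \<Rightarrow> 'p scalar_fun) \<Rightarrow> 'q \<Rightarrow> 'p scalar_fun" where
  "gateaux_adjoint \<Delta> u r j x =
     (\<Sum>i\<in>UNIV. Sum_any (\<lambda>\<alpha>.
        neg_Dop UNIV \<alpha> (\<lambda>y. jet_pd (Dep j \<alpha>) (\<Delta> i) (prolong u y) * r i y) x))"

definition symmetry :: "('l \<Rightarrow> ('p::{finite,linorder}, 'q::finite) jet_fun) \<Rightarrow>
    ('q \<Rightarrow> ('p, 'q) nonlocal_op) \<Rightarrow> bool" where
  "symmetry \<Delta> \<sigma> \<longleftrightarrow> (\<forall>j. \<sigma> j \<in> nonlocal_funs) \<and>
     (\<forall>u. solution \<Delta> u \<longrightarrow> (\<forall>i x. gateaux \<Delta> u (\<lambda>j. \<sigma> j u) i x = 0))"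

definition adjoint_symmetry :: "('l::finite \<Rightarrow> ('p::{finite,linorder}, 'q::finite) jet_fun) \<Rightarrow>
    ('l \<Rightarrow> ('p, 'q) nonlocal_op) \<Rightarrow> bool" where
  "adjoint_symmetry \<Delta> \<rho> \<longleftrightarrow> (\<forall>i. \<rho> i \<in> nonlocal_funs) \<and>
     (\<forall>u. solution \<Delta> u \<longrightarrow> (\<forall>j x. gateaux_adjoint \<Delta> u (\<lambda>i. \<rho> i u) j x = 0))"

definition conservation_law :: "('l \<Rightarrow> ('p::{finite,linorder}, 'q::finite) jet_fun) \<Rightarrow>
    ('p \<Rightarrow> ('p, 'q) nonlocal_op) \<Rightarrow> bool" where
  "conservation_law \<Delta> P \<longleftrightarrow> (\<forall>k. P k \<in> nonlocal_funs) \<and>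
     (\<forall>u. solution \<Delta> u \<longrightarrow> (\<forall>x. (\<Sum>k\<in>UNIV. pd k (P k u) x) = 0))"

end

theory Submission
  imports Defs
begin

text \<open>
  For a fixed triple \<open>(i, j, \<alpha>)\<close> put $A = \rho_i\,\partial\Delta_i/\partial u^j_\alpha$ and
  $S = \sigma_j$. By the product rule the $k$-th divergence term telescopes in \<open>\<beta>\<close> to
  $G_{<k} - G_{\le k}$, where $G_K$ is the product of $(-D)^\alpha A$ restricted to the variables in
  \<open>K\<close> and $D^\alpha S$ restricted to the remaining ones. Summing over \<open>k\<close> telescopes again and leaves
  $A\,D^\alpha S - S\,(-D)^\alpha A$. Hence the total divergence is
  $\rho\cdot\Delta'\sigma - \sigma\cdot(\Delta')^*\rho$, which vanishes on solutions.
\<close>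

section \<open>Smooth functions\<close>

text \<open>Chain rule along a coordinate line. It links the Frechet derivative, by which smoothness
  is stated, to the one-variable \<open>deriv\<close> in the definition of
  \<open>pd\<close>.\<close>

lemma has_derivative_imp_DERIV_line:
  fixes f :: "(real, 'p::finite) vec \<Rightarrow> real"
  assumes "(f has_derivative f') (at (x + s *\<^sub>R axis k 1))"
  shows "((\<lambda>t. f (x + t *\<^sub>R axis k 1)) has_real_derivative f' (axis k 1)) (at s)"
proof -
  have "((\<lambda>t. f (x + t *\<^sub>R axis k 1)) has_derivative (\<lambda>h. f' (h *\<^sub>R axis k 1))) (at s)"
    by (rule has_derivative_compose[where g = f and f = "\<lambda>t. x + t *\<^sub>R axis k 1", OF _ assms])
      (auto intro!: derivative_eq_intros)
  moreover have "(\<lambda>h. f' (h *\<^sub>R axis k 1)) = (*) (f' (axis k 1))"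
    using assms has_derivative_linear linear_cmul by fastforce
  ultimately show ?thesis
    by (simp add: has_field_derivative_def)
qed

lemma pd_eq:
  assumes "(f has_derivative f') (at x)"
  shows "pd k f x = f' (axis k 1)"
  unfolding pd_def
  by (rule DERIV_imp_deriv, rule has_derivative_imp_DERIV_line) (use assms in simp)

text \<open>Stated at an arbitrary parameter \<open>s\<close>, because the mean value theorem needs
  the derivative along a whole segment of the line.\<close>

lemma DERIV_line:
  assumes "f differentiable_on UNIV"
  shows "((\<lambda>t. f (x + t *\<^sub>R axis k 1)) has_real_derivative pd k f (x + s *\<^sub>R axis k 1)) (at s)"
proof -
  obtain f' where f': "(f has_derivative f') (at (x + s *\<^sub>R axis k 1))"
    using assms by (auto simp: differentiable_on_def differentiable_def)
  show ?thesis
    using has_derivative_imp_DERIV_line[OF f'] pd_eq[OF f'] by simp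
qed

lemma DERIV_pd:
  assumes "f differentiable_on UNIV"
  shows "((\<lambda>t. f (x + t *\<^sub>R axis k 1)) has_real_derivative pd k f x) (at 0)"
  using DERIV_line[OF assms, of x k 0] by simp

lemma pd_add:
  assumes "f differentiable_on UNIV" "g differentiable_on UNIV"
  shows "pd k (\<lambda>x. f x + g x) = (\<lambda>x. pd k f x + pd k g x)"
  unfolding pd_def[of k "\<lambda>x. f x + g x"]
  by (intro ext DERIV_imp_deriv DERIV_add DERIV_pd assms)

lemma pd_minus:
  assumes "f differentiable_on UNIV"
  shows "pd k (\<lambda>x. - f x) = (\<lambda>x. - pd k f x)"
  unfolding pd_def[of k "\<lambda>x. - f x"]
  by (intro ext DERIV_imp_deriv DERIV_minus DERIV_pd assms)

lemma pd_mult: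
  assumes "f differentiable_on UNIV" "g differentiable_on UNIV"
  shows "pd k (\<lambda>x. f x * g x) = (\<lambda>x. pd k f x * g x + f x * pd k g x)"
proof
  fix x
  show "pd k (\<lambda>x. f x * g x) x = pd k f x * g x + f x * pd k g x"
    unfolding pd_def[of k "\<lambda>x. f x * g x"]
    using DERIV_mult[OF DERIV_pd[OF assms(1)] DERIV_pd[OF assms(2)], of x k]
    by (intro DERIV_imp_deriv) (simp add: algebra_simps)
qed

lemma pd_const [simp]: "pd k (\<lambda>x. c) = (\<lambda>x. 0)"
  by (simp add: pd_def fun_eq_iff)

text \<open>The recursive form of smoothness. In \<open>foldr\<close> the last list element acts
  first, so appending \<open>k\<close> to the list amounts to starting from \<open>pd k f\<close>;
  hence the case split at the end of the list.\<close>

lemma smooth_iff: "smooth f \<longleftrightarrow> f differentiable_on UNIV \<and> (\<forall>k. smooth (pd k f))"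
proof
  assume f: "smooth f"
  have "foldr pd ks (pd k f) differentiable_on UNIV" for ks k
    using f[unfolded smooth_def, rule_format, of "ks @ [k]"] by simp
  moreover have "f differentiable_on UNIV"
    using f[unfolded smooth_def, rule_format, of "[]"] by simp
  ultimately show "f differentiable_on UNIV \<and> (\<forall>k. smooth (pd k f))"
    by (simp add: smooth_def)
next
  assume f: "f differentiable_on UNIV \<and> (\<forall>k. smooth (pd k f))"
  show "smooth f"
    unfolding smooth_def
  proof
    fix ks show "foldr pd ks f differentiable_on UNIV"
      using f by (cases ks rule: rev_cases) (auto simp: smooth_def)
  qed
qed

lemma smooth_imp_differentiable: "smooth f \<Longrightarrow> f differentiable_on UNIV"
  using smooth_iff by blast

lemma smooth_pd: "smooth f \<Longrightarrow> smooth (pd k f)"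
  using smooth_iff by blast

text \<open>The product and chain rules do not return generators but sums of products of generators
  and smooth functions; this closure is what such derivatives stay in.\<close>

inductive_set smooth_alg :: "'p::finite scalar_fun set \<Rightarrow> 'p scalar_fun set"
  for S :: "'p scalar_fun set" where
  base: "f \<in> S \<Longrightarrow> f \<in> smooth_alg S"
| smooth: "smooth f \<Longrightarrow> f \<in> smooth_alg S"
| add: "f \<in> smooth_alg S \<Longrightarrow> g \<in> smooth_alg S \<Longrightarrow> (\<lambda>x. f x + g x) \<in> smooth_alg S"
| mult: "f \<in> smooth_alg S \<Longrightarrow> g \<in> smooth_alg S \<Longrightarrow> (\<lambda>x. f x * g x) \<in> smooth_alg S"

text \<open>
  Coinduction principle for smoothness: it suffices that partial derivatives stay in the algebra
  generated by \<open>S\<close> and the smooth functions.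
\<close>

lemma smooth_alg_imp_smooth:
  assumes S: "\<And>f. f \<in> S \<Longrightarrow> f differentiable_on UNIV \<and> (\<forall>k. pd k f \<in> smooth_alg S)"
    and "f \<in> smooth_alg S"
  shows "smooth f"
proof -
  have step: "f differentiable_on UNIV \<and> (\<forall>k. pd k f \<in> smooth_alg S)"
    if "f \<in> smooth_alg S" for f
    using that
  proof induction
    case (smooth f)
    then show ?case
      using smooth_iff smooth_alg.smooth by blast
  next
    case (add f g)
    then show ?case
      by (auto simp: pd_add intro: smooth_alg.add)
  next
    case (mult f g)
    then show ?case
      by (auto simp: pd_mult intro!: smooth_alg.add smooth_alg.mult)
  qed (use S in blast)
  have "foldr pd ks f \<in> smooth_alg S" for ks
    by (induction ks) (use assms(2) step in auto)
  with step show ?thesis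
    by (simp add: smooth_def)
qed

text \<open>With no extra generators, the coinduction principle says that every member of the
  algebra generated by the smooth functions is smooth.\<close>

lemma smooth_add: "smooth f \<Longrightarrow> smooth g \<Longrightarrow> smooth (\<lambda>x. f x + g x)"
  by (rule smooth_alg_imp_smooth[of "{}"]) (auto intro: smooth_alg.intros)

lemma smooth_mult: "smooth f \<Longrightarrow> smooth g \<Longrightarrow> smooth (\<lambda>x. f x * g x)"
  by (rule smooth_alg_imp_smooth[of "{}"]) (auto intro: smooth_alg.intros)

lemma smooth_const: "smooth (\<lambda>x. c)"
  by (rule smooth_alg_imp_smooth[of "range (\<lambda>c x. c)"]) (auto intro: smooth_alg.base)

lemma smooth_minus: "smooth f \<Longrightarrow> smooth (\<lambda>x. - f x)"
  using smooth_mult[OF smooth_const[of "-1"], of f] by simp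

lemma smooth_sum: "(\<And>i. i \<in> I \<Longrightarrow> smooth (f i)) \<Longrightarrow> smooth (\<lambda>x. \<Sum>i\<in>I. f i x)"
  by (induction I rule: infinite_finite_induct) (auto intro: smooth_const smooth_add)

lemma pd_sum:
  assumes "\<And>i. i \<in> I \<Longrightarrow> smooth (f i)"
  shows "pd k (\<lambda>x. \<Sum>i\<in>I. f i x) = (\<lambda>x. \<Sum>i\<in>I. pd k (f i) x)"
  using assms
  by (induction I rule: infinite_finite_induct)
    (simp_all add: pd_add smooth_imp_differentiable smooth_sum)

lemma smooth_coord: "smooth (\<lambda>x :: (real, 'p::finite) vec. x $ k)"
proof -
  have d: "((\<lambda>x :: (real, 'p) vec. x $ k) has_derivative (\<lambda>h. h $ k)) (at x)" for x
    by (intro bounded_linear.has_derivative[OF bounded_linear_vec_nth] has_derivative_ident)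
  have "smooth (pd l (\<lambda>x :: (real, 'p) vec. x $ k))" for l
    unfolding pd_eq[OF d, abs_def] by (rule smooth_const)
  with d show ?thesis
    unfolding smooth_iff[of "\<lambda>x. x $ k"] differentiable_on_def differentiable_def
    using has_derivative_at_withinI by blast
qed

section \<open>Symmetry of mixed partial derivatives\<close>

text \<open>The second difference is the increment, in direction \<open>i\<close>, of the difference
  of \<open>f\<close> in direction \<open>j\<close>. The mean value theorem in direction
  \<open>i\<close> produces \<open>pd i f\<close>, and a second use in direction \<open>j\<close>
  produces the mixed derivative.\<close>

lemma second_difference_mean_value:
  fixes f :: "'p::finite scalar_fun"
  assumes "smooth f" "h > 0"
  obtains s t where "0 < s" "s < h" "0 < t" "t < h"
    "f (x + h *\<^sub>R axis i 1 + h *\<^sub>R axis j 1) - f (x + h *\<^sub>R axis i 1)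
       - f (x + h *\<^sub>R axis j 1) + f x
     = h * h * pd j (pd i f) (x + s *\<^sub>R axis i 1 + t *\<^sub>R axis j 1)"
proof -
  define \<phi> where "\<phi> s = f ((x + h *\<^sub>R axis j 1) + s *\<^sub>R axis i 1) - f (x + s *\<^sub>R axis i 1)" for s
  define \<phi>' where "\<phi>' s = pd i f ((x + h *\<^sub>R axis j 1) + s *\<^sub>R axis i 1)
      - pd i f (x + s *\<^sub>R axis i 1)" for s
  have "DERIV \<phi> s :> \<phi>' s" for s
    unfolding \<phi>_def \<phi>'_def
    by (intro DERIV_diff DERIV_line smooth_imp_differentiable assms)
  then obtain s where s: "0 < s" "s < h" "\<phi> h - \<phi> 0 = (h - 0) * \<phi>' s"
    using MVT2[OF \<open>h > 0\<close>, of \<phi> \<phi>'] by blast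
  have "DERIV (\<lambda>t. pd i f ((x + s *\<^sub>R axis i 1) + t *\<^sub>R axis j 1)) t
      :> pd j (pd i f) ((x + s *\<^sub>R axis i 1) + t *\<^sub>R axis j 1)" for t
    by (intro DERIV_line smooth_imp_differentiable smooth_pd assms)
  then obtain t where t: "0 < t" "t < h"
    "pd i f ((x + s *\<^sub>R axis i 1) + h *\<^sub>R axis j 1) - pd i f ((x + s *\<^sub>R axis i 1) + 0 *\<^sub>R axis j 1)
      = (h - 0) * pd j (pd i f) ((x + s *\<^sub>R axis i 1) + t *\<^sub>R axis j 1)"
    using MVT2[OF \<open>h > 0\<close>, of "\<lambda>t. pd i f ((x + s *\<^sub>R axis i 1) + t *\<^sub>R axis j 1)"
        "\<lambda>t. pd j (pd i f) ((x + s *\<^sub>R axis i 1) + t *\<^sub>R axis j 1)"] by blast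
  show ?thesis
  proof (rule that[OF s(1,2) t(1,2)])
    have "\<phi>' s = h * pd j (pd i f) (x + s *\<^sub>R axis i 1 + t *\<^sub>R axis j 1)"
      using t(3) by (simp add: \<phi>'_def add_ac)
    with s(3) show "f (x + h *\<^sub>R axis i 1 + h *\<^sub>R axis j 1) - f (x + h *\<^sub>R axis i 1)
       - f (x + h *\<^sub>R axis j 1) + f x
     = h * h * pd j (pd i f) (x + s *\<^sub>R axis i 1 + t *\<^sub>R axis j 1)"
      by (simp add: \<phi>_def add_ac)
  qed
qed

lemma dist_two_axes:
  fixes x :: "(real, 'p::finite) vec"
  assumes "0 < s" "s < h" "0 < t" "t < h"
  shows "dist (x + s *\<^sub>R axis i 1 + t *\<^sub>R axis j 1) x < 2 * h"
proof -
  have "dist (x + s *\<^sub>R axis i 1 + t *\<^sub>R axis j 1) x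
      \<le> norm (s *\<^sub>R axis i 1 :: (real, 'p) vec) + norm (t *\<^sub>R axis j 1 :: (real, 'p) vec)"
    using norm_triangle_ineq[of "s *\<^sub>R axis i 1 :: (real, 'p) vec" "t *\<^sub>R axis j 1"]
    by (simp add: dist_norm add.assoc)
  with assms show ?thesis by simp
qed

text \<open>Schwarz's theorem. The second difference is symmetric in \<open>i\<close> and
  \<open>j\<close>, so the two mixed derivatives agree at suitable points arbitrarily close to
  \<open>x\<close>; continuity carries the equality to \<open>x\<close>.\<close>

lemma pd_commute:
  assumes "smooth f"
  shows "pd i (pd j f) = pd j (pd i f)"
proof
  fix x
  show "pd i (pd j f) x = pd j (pd i f) x"
  proof (rule ccontr)
    assume ne: "pd i (pd j f) x \<noteq> pd j (pd i f) x"
    \<comment> \<open>Half the gap between the two values: one number cannot be closer than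
      \<open>e\<close> to both of them.\<close>
    define e where "e = dist (pd i (pd j f) x) (pd j (pd i f) x) / 2"
    have "e > 0" using ne by (simp add: e_def)
    have cont: "\<exists>d>0. \<forall>y. dist y x < d \<longrightarrow> dist (g y) (g x) < e" if "smooth g" for g
      using differentiable_imp_continuous_on[OF smooth_imp_differentiable[OF that]] \<open>e > 0\<close>
      by (auto simp: continuous_on_iff)
    obtain d1 where d1: "d1 > 0" "\<And>y. dist y x < d1 \<Longrightarrow> dist (pd i (pd j f) y) (pd i (pd j f) x) < e"
      using cont[OF smooth_pd[OF smooth_pd[OF assms]]] by blast
    obtain d2 where d2: "d2 > 0" "\<And>y. dist y x < d2 \<Longrightarrow> dist (pd j (pd i f) y) (pd j (pd i f) x) < e"
      using cont[OF smooth_pd[OF smooth_pd[OF assms]]] by blast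
    \<comment> \<open>The intermediate points lie within \<open>2 * h\<close> of \<open>x\<close>,
      hence the division by two.\<close>
    define h where "h = min d1 d2 / 2"
    have h: "h > 0" "2 * h \<le> d1" "2 * h \<le> d2"
      using d1 d2 by (auto simp: h_def)
    obtain s t where 1: "0 < s" "s < h" "0 < t" "t < h"
      "f (x + h *\<^sub>R axis i 1 + h *\<^sub>R axis j 1) - f (x + h *\<^sub>R axis i 1)
         - f (x + h *\<^sub>R axis j 1) + f x
       = h * h * pd j (pd i f) (x + s *\<^sub>R axis i 1 + t *\<^sub>R axis j 1)"
      using second_difference_mean_value[OF assms h(1), of x i j] by blast
    obtain s' t' where 2: "0 < s'" "s' < h" "0 < t'" "t' < h"
      "f (x + h *\<^sub>R axis j 1 + h *\<^sub>R axis i 1) - f (x + h *\<^sub>R axis j 1)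
         - f (x + h *\<^sub>R axis i 1) + f x
       = h * h * pd i (pd j f) (x + s' *\<^sub>R axis j 1 + t' *\<^sub>R axis i 1)"
      using second_difference_mean_value[OF assms h(1), of x j i] by blast
    have "h * h * pd j (pd i f) (x + s *\<^sub>R axis i 1 + t *\<^sub>R axis j 1)
        = h * h * pd i (pd j f) (x + s' *\<^sub>R axis j 1 + t' *\<^sub>R axis i 1)"
      using 1(5) 2(5) add.commute[of "h *\<^sub>R axis i 1" "h *\<^sub>R axis j (1::real)"]
      by (simp only: add.assoc)
    then have eq: "pd j (pd i f) (x + s *\<^sub>R axis i 1 + t *\<^sub>R axis j 1)
        = pd i (pd j f) (x + s' *\<^sub>R axis j 1 + t' *\<^sub>R axis i 1)"
      using h by simp
    have "dist (pd j (pd i f) (x + s *\<^sub>R axis i 1 + t *\<^sub>R axis j 1)) (pd j (pd i f) x) < e"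
      by (rule d2(2)) (use dist_two_axes[OF 1(1-4), of x i j] h in linarith)
    moreover
    have "dist (pd i (pd j f) (x + s' *\<^sub>R axis j 1 + t' *\<^sub>R axis i 1)) (pd i (pd j f) x) < e"
      by (rule d1(2)) (use dist_two_axes[OF 2(1-4), of x j i] h in linarith)
    ultimately show False
      unfolding eq e_def dist_real_def by (simp add: field_simps abs_if split: if_splits)
  qed
qed

section \<open>The operators $D^\<alpha>$ and $(-D)^\<alpha>$\<close>

lemma smooth_neg_pd: "smooth f \<Longrightarrow> smooth (neg_pd k f)"
  unfolding neg_pd_def[abs_def] by (intro smooth_minus smooth_pd)

lemma smooth_funpow:
  fixes F :: "'p::finite scalar_fun \<Rightarrow> 'p scalar_fun"
  shows "(\<And>f. smooth f \<Longrightarrow> smooth (F f)) \<Longrightarrow> smooth f \<Longrightarrow> smooth ((F ^^ n) f)"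
  by (induction n) auto

lemma smooth_foldr:
  "(\<And>k f. smooth f \<Longrightarrow> smooth (F k f)) \<Longrightarrow> smooth f \<Longrightarrow> smooth (foldr F ks f)"
  by (induction ks) auto

lemma smooth_pd_funpow: "smooth f \<Longrightarrow> smooth ((pd k ^^ n) f)"
  by (simp add: smooth_funpow smooth_pd)

lemma smooth_neg_pd_funpow: "smooth f \<Longrightarrow> smooth ((neg_pd k ^^ n) f)"
  by (simp add: smooth_funpow smooth_neg_pd)

lemma smooth_Dop: "smooth f \<Longrightarrow> smooth (Dop K \<alpha> f)"
  unfolding Dop_def by (rule smooth_foldr) (auto intro: smooth_pd_funpow)

lemma smooth_neg_Dop: "smooth f \<Longrightarrow> smooth (neg_Dop K \<alpha> f)"
  unfolding neg_Dop_def by (rule smooth_foldr) (auto intro: smooth_neg_pd_funpow)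

lemma neg_pd_commute: "smooth f \<Longrightarrow> neg_pd i (neg_pd j f) = neg_pd j (neg_pd i f)"
  unfolding neg_pd_def[abs_def]
  by (simp add: pd_minus[OF smooth_imp_differentiable] smooth_pd pd_commute[of f i j])

lemma neg_pd_funpow_commute:
  "smooth f \<Longrightarrow> neg_pd i ((neg_pd j ^^ n) f) = (neg_pd j ^^ n) (neg_pd i f)"
proof (induction n)
  case (Suc n)
  then have "neg_pd i (neg_pd j ((neg_pd j ^^ n) f)) = neg_pd j (neg_pd i ((neg_pd j ^^ n) f))"
    by (intro neg_pd_commute smooth_neg_pd_funpow)
  with Suc show ?case by simp
qed simp

text \<open>Lets the outer derivative of a divergence term pass through the operators of lower index
  and raise the inner power of \<open>neg_pd k\<close>. This is where equality of mixed derivatives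
  enters the integration by parts.\<close>

lemma neg_pd_neg_Dop_commute:
  assumes "smooth f"
  shows "neg_pd i (neg_Dop K \<alpha> f) = neg_Dop K \<alpha> (neg_pd i f)"
proof -
  have "neg_pd i (foldr (\<lambda>k. neg_pd k ^^ \<alpha> k) ks f)
      = foldr (\<lambda>k. neg_pd k ^^ \<alpha> k) ks (neg_pd i f)" for ks
    by (induction ks)
      (simp_all add: neg_pd_funpow_commute smooth_foldr smooth_neg_pd_funpow assms)
  then show ?thesis by (simp add: neg_Dop_def)
qed

lemma neg_pd_zero [simp]: "neg_pd k (\<lambda>x. 0) = (\<lambda>x. 0)"
  by (simp add: neg_pd_def[abs_def])

lemma neg_pd_funpow_zero [simp]: "(neg_pd k ^^ n) (\<lambda>x. 0) = (\<lambda>x. 0)"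
  by (induction n) auto

lemma neg_Dop_zero [simp]: "neg_Dop K \<alpha> (\<lambda>x. 0) = (\<lambda>x. 0)"
proof -
  have "foldr (\<lambda>k. neg_pd k ^^ \<alpha> k) ks (\<lambda>x. 0) = (\<lambda>x. 0)" for ks
    by (induction ks) auto
  then show ?thesis by (simp add: neg_Dop_def)
qed

lemma Dop_empty [simp]: "Dop {} \<alpha> f = f"
  by (simp add: Dop_def)

lemma neg_Dop_empty [simp]: "neg_Dop {} \<alpha> f = f"
  by (simp add: neg_Dop_def)

text \<open>The least index \<open>k\<close> of the segment comes first in the sorted list, so its
  operator is outermost and splits off without commuting anything.\<close>

lemma Dop_atLeast:
  fixes k :: "'p::{finite,linorder}"
  shows "Dop {k..} \<alpha> f = (pd k ^^ \<alpha> k) (Dop {k<..} \<alpha> f)"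
proof -
  have "sorted_list_of_set {k..} = k # sorted_list_of_set {k<..}"
    by (rule sorted_distinct_set_unique) (auto simp: less_imp_le)
  then show ?thesis by (simp add: Dop_def)
qed

text \<open>Here \<open>k\<close> is the greatest index of the segment, so its operator is
  innermost.\<close>

lemma neg_Dop_atMost:
  fixes k :: "'p::{finite,linorder}"
  shows "neg_Dop {..k} \<alpha> f = neg_Dop {..<k} \<alpha> ((neg_pd k ^^ \<alpha> k) f)"
proof -
  have "sorted_list_of_set {..k} = sorted_list_of_set {..<k} @ [k]"
    by (rule sorted_distinct_set_unique) (auto simp: less_imp_le sorted_append)
  then show ?thesis by (simp add: neg_Dop_def)
qed

section \<open>Integration by parts\<close>

text \<open>In the product rule, differentiating the left factor raises \<beta> and changes the
  sign, while differentiating the right factor restores its missing derivative. Each summand is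
  therefore \<open>T \<beta> - T (Suc \<beta>)\<close>, and only the two end values remain.\<close>

lemma pd_telescope:
  fixes k :: "'p::{finite,linorder}"
  assumes A: "smooth A" and S: "smooth S"
  shows "(\<Sum>\<beta><\<alpha> k. pd k (\<lambda>x. neg_Dop {..<k} \<alpha> ((neg_pd k ^^ \<beta>) A) x *
      (pd k ^^ (\<alpha> k - \<beta> - 1)) (Dop {k<..} \<alpha> S) x) x)
    = neg_Dop {..<k} \<alpha> A x * Dop {k..} \<alpha> S x - neg_Dop {..k} \<alpha> A x * Dop {k<..} \<alpha> S x"
proof -
  define B where "B = Dop {k<..} \<alpha> S"
  have B: "smooth B" unfolding B_def by (intro smooth_Dop S)
  define T where "T \<beta> = neg_Dop {..<k} \<alpha> ((neg_pd k ^^ \<beta>) A) x * (pd k ^^ (\<alpha> k - \<beta>)) B x" for \<beta>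
  have "pd k (\<lambda>x. neg_Dop {..<k} \<alpha> ((neg_pd k ^^ \<beta>) A) x * (pd k ^^ (\<alpha> k - \<beta> - 1)) B x) x
      = T \<beta> - T (Suc \<beta>)" if "\<beta> < \<alpha> k" for \<beta>
  proof -
    have "pd k (neg_Dop {..<k} \<alpha> ((neg_pd k ^^ \<beta>) A)) x
        = - neg_pd k (neg_Dop {..<k} \<alpha> ((neg_pd k ^^ \<beta>) A)) x"
      by (simp add: neg_pd_def)
    also have "\<dots> = - neg_Dop {..<k} \<alpha> ((neg_pd k ^^ Suc \<beta>) A) x"
      by (simp add: neg_pd_neg_Dop_commute smooth_neg_pd_funpow A)
    finally have "pd k (neg_Dop {..<k} \<alpha> ((neg_pd k ^^ \<beta>) A)) x
        = - neg_Dop {..<k} \<alpha> ((neg_pd k ^^ Suc \<beta>) A) x" .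
    \<comment> \<open>Since \<beta> lies below \<open>\<alpha> k\<close>, the truncated subtraction
      is the true predecessor of \<open>\<alpha> k - \<beta>\<close>.\<close>
    moreover have "pd k ((pd k ^^ (\<alpha> k - \<beta> - 1)) B) = (pd k ^^ (\<alpha> k - \<beta>)) B"
      using that Suc_diff_Suc[of \<beta> "\<alpha> k"] funpow.simps(2)[of "\<alpha> k - Suc \<beta>" "pd k"] by simp
    ultimately show ?thesis
      by (simp add: T_def pd_mult smooth_imp_differentiable smooth_neg_Dop smooth_neg_pd_funpow
          smooth_pd_funpow A B)
  qed
  then have "(\<Sum>\<beta><\<alpha> k. pd k (\<lambda>x. neg_Dop {..<k} \<alpha> ((neg_pd k ^^ \<beta>) A) x *
      (pd k ^^ (\<alpha> k - \<beta> - 1)) B x) x) = (\<Sum>\<beta><\<alpha> k. T \<beta> - T (Suc \<beta>))"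
    by simp
  also have "\<dots> = T 0 - T (\<alpha> k)"
    by (rule sum_lessThan_telescope')
  finally show ?thesis
    by (simp add: T_def B_def Dop_atLeast neg_Dop_atMost)
qed

text \<open>The index type has no successor function, so the telescoping is an induction that adds a
  new maximum. Only initial segments telescope, whence the premise that \<open>K\<close> is closed
  downwards: such a \<open>K\<close> with new maximum \<open>b\<close> is \<open>{..<b}\<close>, and
  it becomes \<open>{..b}\<close>.\<close>

lemma sum_telescope_linorder:
  fixes G :: "'p::{finite,linorder} set \<Rightarrow> real"
  shows "(\<Sum>k\<in>UNIV. G {..<k} - G {..k}) = G {} - G UNIV"
proof -
  have "(\<forall>a\<in>K. {..a} \<subseteq> K) \<longrightarrow> (\<Sum>k\<in>K. G {..<k} - G {..k}) = G {} - G K" for K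
    using finite[of K]
  proof (induction K rule: finite_linorder_max_induct)
    case (insert b K)
    show ?case
    proof
      assume down: "\<forall>a\<in>insert b K. {..a} \<subseteq> insert b K"
      then have "{..b} \<subseteq> insert b K" by simp
      then have K: "K = {..<b}" "insert b K = {..b}"
        using insert.hyps by (auto simp: less_imp_le subset_iff order.strict_iff_order)
      have "\<forall>a\<in>K. {..a} \<subseteq> K"
        unfolding K(1) by auto
      with insert have "(\<Sum>k\<in>K. G {..<k} - G {..k}) = G {} - G K" by blast
      moreover have "b \<notin> K" using insert.hyps by blast
      ultimately have "(\<Sum>k\<in>insert b K. G {..<k} - G {..k}) = G {..<b} - G {..b} + (G {} - G K)"
        by simp
      then show "(\<Sum>k\<in>insert b K. G {..<k} - G {..k}) = G {} - G (insert b K)"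
        unfolding K(2) using K(1) by simp
    qed
  qed simp_all
  from this[of UNIV] show ?thesis by simp
qed

text \<open>Lagrange's identity for a single multi-index: moving the derivatives from
  \<open>S\<close> to \<open>A\<close> one at a time costs exactly a divergence.\<close>

lemma divergence_eq:
  assumes "smooth A" "smooth S"
  shows "(\<Sum>k\<in>UNIV. \<Sum>\<beta><\<alpha> k. pd k (\<lambda>x. neg_Dop {..<k} \<alpha> ((neg_pd k ^^ \<beta>) A) x *
      (pd k ^^ (\<alpha> k - \<beta> - 1)) (Dop {k<..} \<alpha> S) x) x)
    = A x * Dop UNIV \<alpha> S x - neg_Dop UNIV \<alpha> A x * S x"
proof -
  \<comment> \<open>Taking the complement for the second factor makes the boundary terms values of
    one set function, as the telescoping over \<open>k\<close> requires.\<close>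
  define G where "G K = neg_Dop K \<alpha> A x * Dop (- K) \<alpha> S x" for K
  have "- {..<k} = {k..}" "- {..k} = {k<..}" for k :: 'a
    by auto
  then show ?thesis
    unfolding pd_telescope[OF assms] using sum_telescope_linorder[of G] by (simp add: G_def)
qed

section \<open>Differential functions along a smooth field\<close>

lemma jet_smooth_jet_pd:
  assumes "jet_smooth f"
  shows "jet_smooth (jet_pd v f)"
  unfolding jet_smooth_def
proof
  fix vs
  show "continuous_on UNIV (foldr jet_pd vs (jet_pd v f)) \<and>
     (\<forall>w z. (\<lambda>t. foldr jet_pd vs (jet_pd v f) (z(w := t))) differentiable at (z w))"
    using assms[unfolded jet_smooth_def, rule_format, of "vs @ [v]"] by simp
qed

lemma jet_smooth_continuous: "jet_smooth f \<Longrightarrow> continuous_on UNIV f"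
  unfolding jet_smooth_def by (metis foldr.simps(1) id_apply)

text \<open>Smoothness is used at the modified point \<open>z(v := s)\<close>, where a further
  update of \<open>v\<close> overwrites the first. This gives the derivative at every value of the
  coordinate, as the mean value theorem needs.\<close>

lemma jet_smooth_DERIV:
  assumes "jet_smooth f"
  shows "((\<lambda>t. f (z(v := t))) has_real_derivative jet_pd v f (z(v := s))) (at s)"
proof -
  have "(\<lambda>t. foldr jet_pd [] f ((z(v := s))(v := t))) differentiable at ((z(v := s)) v)"
    using assms unfolding jet_smooth_def by blast
  then have "(\<lambda>t. f (z(v := t))) differentiable at s"
    by simp
  then obtain D where "((\<lambda>t. f (z(v := t))) has_real_derivative D) (at s)"
    using real_differentiable_def by blast
  then show ?thesis
    using DERIV_imp_deriv by (fastforce simp: jet_pd_def)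
qed

text \<open>A coordinate of order above \<open>n\<close> does not affect \<open>f\<close>, so a
  constant is differentiated. This makes the sums over all multi-indices finite.\<close>

lemma order_le_jet_pd_eq_0:
  fixes f :: "('p::finite, 'q::finite) jet_fun"
  assumes "order_le n f" "n < (\<Sum>k\<in>UNIV. \<alpha> k)"
  shows "jet_pd (Dep j \<alpha>) f z = 0"
proof -
  have "f (z(Dep j \<alpha> := t)) = f z" for t
    by (rule assms(1)[unfolded order_le_def, rule_format]) (use assms(2) in auto)
  then show ?thesis
    by (simp add: jet_pd_def)
qed

text \<open>Besides the updated points, the base value \<open>z v\<close> enters
  \<open>jet_pd\<close>. It is determined by the coordinates of order at most \<open>n\<close>
  unless \<open>v\<close> has higher order, and then the derivative vanishes identically.\<close>

lemma order_le_jet_pd: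
  fixes f :: "('p::finite, 'q::finite) jet_fun"
  assumes "order_le n f"
  shows "order_le n (jet_pd v f)"
proof (cases "\<exists>j \<alpha>. v = Dep j \<alpha> \<and> n < (\<Sum>k\<in>UNIV. \<alpha> k)")
  case True
  then show ?thesis
    using order_le_jet_pd_eq_0[OF assms] by (auto simp: order_le_def)
next
  case False
  show ?thesis
    unfolding order_le_def
  proof (intro allI impI)
    fix z w :: "('p, 'q) jet"
    assume I: "\<forall>k. z (Indep k) = w (Indep k)"
      and D: "\<forall>j \<alpha>. (\<Sum>k\<in>UNIV. \<alpha> k) \<le> n \<longrightarrow> z (Dep j \<alpha>) = w (Dep j \<alpha>)"
    have "f (z(v := t)) = f (w(v := t))" for t
      by (rule assms[unfolded order_le_def, rule_format]) (use I D in auto)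
    moreover have "z v = w v"
      using False I D by (cases v) (auto simp: not_less)
    ultimately show "jet_pd v f z = jet_pd v f w"
      by (simp add: jet_pd_def)
  qed
qed

lemma local_funs_jet_pd: "f \<in> local_funs \<Longrightarrow> jet_pd v f \<in> local_funs"
  by (auto simp: local_funs_def intro: order_le_jet_pd jet_smooth_jet_pd)

section \<open>The chain rule on jet space\<close>

text \<open>The remainder splits into \<phi> times the remainder of \<open>g\<close>, plus
  \<open>\<phi> x - c\<close> times a bounded quotient. Asking only for a limit of \<phi> allows it
  to be a derivative at an intermediate point whose dependence on \<open>x\<close> is
  uncontrolled.\<close>

lemma has_derivative_mult_diff:
  fixes g \<phi> :: "'a::real_normed_vector \<Rightarrow> real"
  assumes g: "(g has_derivative g') (at a)" and \<phi>: "(\<phi> \<longlongrightarrow> c) (at a)"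
  shows "((\<lambda>x. \<phi> x * (g x - g a)) has_derivative (\<lambda>h. c * g' h)) (at a)"
proof (rule has_derivativeI)
  note bl = has_derivative_bounded_linear[OF g]
  show "bounded_linear (\<lambda>h. c * g' h)"
    by (rule bounded_linear_const_mult[OF bl])
  obtain K where K: "\<And>h. norm (g' h) \<le> norm h * K"
    using bounded_linear.bounded[OF bl] by blast
  have "((\<lambda>x. (g x - g a - g' (x - a)) /\<^sub>R norm (x - a)) \<longlongrightarrow> 0) (at a)"
    using g by (simp add: has_derivative_at_within)
  from tendsto_mult[OF \<phi> this]
  have 1: "((\<lambda>x. \<phi> x * ((g x - g a - g' (x - a)) /\<^sub>R norm (x - a))) \<longlongrightarrow> 0) (at a)"
    by simp
  have lim: "((\<lambda>x. \<bar>\<phi> x - c\<bar> * \<bar>K\<bar>) \<longlongrightarrow> 0) (at a)"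
    using \<phi> by (intro tendsto_mult_left_zero tendsto_rabs_zero LIM_zero)
  have "norm (g' h /\<^sub>R norm h) \<le> \<bar>K\<bar>" for h
  proof (cases "h = 0")
    case False
    have "norm (g' h) \<le> norm h * \<bar>K\<bar>"
      using K[of h] by (rule order_trans) (simp add: mult_left_mono)
    then show ?thesis using False by (simp add: divide_simps mult.commute)
  qed simp
  then have "norm ((\<phi> x - c) * (g' (x - a) /\<^sub>R norm (x - a))) \<le> \<bar>\<phi> x - c\<bar> * \<bar>K\<bar>" for x
    unfolding norm_mult by (auto intro: mult_left_mono)
  then have 2: "((\<lambda>x. (\<phi> x - c) * (g' (x - a) /\<^sub>R norm (x - a))) \<longlongrightarrow> 0) (at a)"
    by (intro Lim_null_comparison[OF _ lim] always_eventually allI)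
  have "\<phi> x * ((g x - g a - g' (x - a)) /\<^sub>R norm (x - a)) + (\<phi> x - c) * (g' (x - a) /\<^sub>R norm (x - a))
      = (\<phi> x * (g x - g a) - \<phi> a * (g a - g a) - c * g' (x - a)) /\<^sub>R norm (x - a)" for x
    by (simp add: algebra_simps)
  with tendsto_add[OF 1 2]
  show "((\<lambda>x. (\<phi> x * (g x - g a) - \<phi> a * (g a - g a) - c * g' (x - a)) /\<^sub>R norm (x - a)) \<longlongrightarrow> 0) (at a)"
    by simp
qed

text \<open>Continuity on jet space refers to the product topology, in which convergence is
  coordinatewise.\<close>

lemma tendsto_coordinatewise:
  fixes f :: "'a \<Rightarrow> 'b \<Rightarrow> 'c::topological_space"
  assumes "\<And>i. ((\<lambda>x. f x i) \<longlongrightarrow> l i) F"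
  shows "(f \<longlongrightarrow> l) F"
proof -
  have "limitin (product_topology (\<lambda>i. euclidean) UNIV) f l F"
    using assms by (simp add: limitin_componentwise)
  then show ?thesis
    by (simp add: euclidean_product_topology)
qed

text \<open>
  Replacing the coordinates in \<open>D\<close> one at a time reduces the chain rule to the mean value theorem
  in a single coordinate.
\<close>

lemma jet_chain_rule_partial:
  fixes f :: "('p, 'q) jet_fun" and g :: "'a::real_normed_vector \<Rightarrow> ('p, 'q) jet"
  assumes f: "jet_smooth f" and "finite D"
    and g: "\<And>c. c \<in> D \<Longrightarrow> ((\<lambda>x. g x c) has_derivative g' c) (at a)"
  shows "((\<lambda>x. f (override_on (g a) (g x) D)) has_derivative
    (\<lambda>h. \<Sum>c\<in>D. jet_pd c f (g a) * g' c h)) (at a)"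
  using \<open>finite D\<close> g
proof (induction D rule: finite_induct)
  case empty
  then show ?case by simp
next
  case (insert c D)
  \<comment> \<open>The jet in which the coordinates in \<open>D\<close> have moved to their values
    at \<open>x\<close>, while \<open>c\<close> still has its value at \<open>a\<close>.\<close>
  define z where "z x = override_on (g a) (g x) D" for x
  have zc: "z x c = g a c" for x
    using insert.hyps by (simp add: z_def)
  \<comment> \<open>The mean value theorem in the coordinate \<open>c\<close> alone, in either
    direction; if the coordinate has not moved, \<tau> is its common value.\<close>
  have mvt: "\<exists>\<tau>. \<bar>\<tau> - g a c\<bar> \<le> \<bar>g x c - g a c\<bar> \<and>
    f ((z x)(c := g x c)) - f (z x) = jet_pd c f ((z x)(c := \<tau>)) * (g x c - g a c)" for x
  proof -
    have D: "DERIV (\<lambda>t. f ((z x)(c := t))) s :> jet_pd c f ((z x)(c := s))" for s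
      by (rule jet_smooth_DERIV[OF f])
    have zx: "(z x)(c := g a c) = z x"
      using zc by (simp add: fun_upd_idem)
    consider "g x c = g a c" | "g a c < g x c" | "g x c < g a c" by linarith
    then show ?thesis
    proof cases
      case 1
      then show ?thesis using zx by (intro exI[of _ "g a c"]) simp
    next
      case 2
      from MVT2[OF 2, of "\<lambda>t. f ((z x)(c := t))" "\<lambda>s. jet_pd c f ((z x)(c := s))"] D
      obtain s where "g a c < s" "s < g x c"
        "f ((z x)(c := g x c)) - f ((z x)(c := g a c)) = (g x c - g a c) * jet_pd c f ((z x)(c := s))"
        by blast
      then show ?thesis
        using zx by (intro exI[of _ s]) (simp add: mult.commute)
    next
      case 3
      from MVT2[OF 3, of "\<lambda>t. f ((z x)(c := t))" "\<lambda>s. jet_pd c f ((z x)(c := s))"] D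
      obtain s where "g x c < s" "s < g a c"
        "f ((z x)(c := g a c)) - f ((z x)(c := g x c)) = (g a c - g x c) * jet_pd c f ((z x)(c := s))"
        by blast
      then show ?thesis
        using zx by (intro exI[of _ s]) (auto simp: algebra_simps)
    qed
  qed
  then obtain \<tau> where \<tau>: "\<And>x. \<bar>\<tau> x - g a c\<bar> \<le> \<bar>g x c - g a c\<bar>"
    and eq: "\<And>x. f ((z x)(c := g x c)) - f (z x)
      = jet_pd c f ((z x)(c := \<tau> x)) * (g x c - g a c)"
    by metis
  have g_lim: "((\<lambda>x. g x d) \<longlongrightarrow> g a d) (at a)" if "d \<in> insert c D" for d
    using has_derivative_continuous[OF insert.prems[OF that]] by (simp add: isCont_def)
  have "((\<lambda>x. \<bar>g x c - g a c\<bar>) \<longlongrightarrow> 0) (at a)"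
    using g_lim[of c] by (simp add: LIM_zero tendsto_rabs_zero)
  then have "((\<lambda>x. \<tau> x - g a c) \<longlongrightarrow> 0) (at a)"
    by (rule Lim_null_comparison[rotated]) (use \<tau> in simp)
  then have \<tau>_lim: "(\<tau> \<longlongrightarrow> g a c) (at a)"
    by (simp add: LIM_zero_iff)
  \<comment> \<open>The coordinate \<open>c\<close> converges by squeezing, those in
    \<open>D\<close> by continuity of \<open>g\<close>, and all others are constant.\<close>
  have "((\<lambda>x. (z x)(c := \<tau> x)) \<longlongrightarrow> g a) (at a)"
  proof (rule tendsto_coordinatewise)
    fix d
    show "((\<lambda>x. ((z x)(c := \<tau> x)) d) \<longlongrightarrow> g a d) (at a)"
      using \<tau>_lim g_lim[of d] by (cases "d = c"; cases "d \<in> D") (simp_all add: z_def)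
  qed
  then have "((\<lambda>x. jet_pd c f ((z x)(c := \<tau> x))) \<longlongrightarrow> jet_pd c f (g a)) (at a)"
    using continuous_on_tendsto_compose[OF jet_smooth_continuous[OF jet_smooth_jet_pd[OF f]]]
    by fastforce
  then have "((\<lambda>x. jet_pd c f ((z x)(c := \<tau> x)) * (g x c - g a c)) has_derivative
      (\<lambda>h. jet_pd c f (g a) * g' c h)) (at a)"
    by (intro has_derivative_mult_diff insert.prems) auto
  moreover have "((\<lambda>x. f (z x)) has_derivative (\<lambda>h. \<Sum>c\<in>D. jet_pd c f (g a) * g' c h)) (at a)"
    unfolding z_def by (intro insert.IH insert.prems) auto
  ultimately have "((\<lambda>x. jet_pd c f ((z x)(c := \<tau> x)) * (g x c - g a c) + f (z x)) has_derivative
      (\<lambda>h. jet_pd c f (g a) * g' c h + (\<Sum>c\<in>D. jet_pd c f (g a) * g' c h))) (at a)"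
    by (rule has_derivative_add)
  moreover have "jet_pd c f ((z x)(c := \<tau> x)) * (g x c - g a c) + f (z x)
      = f (override_on (g a) (g x) (insert c D))" for x
    unfolding eq[symmetric] by (simp add: z_def override_on_insert)
  ultimately show ?case
    using insert.hyps by simp
qed

lemma finite_multi_indices: "finite {\<alpha> :: 'p::finite multi_index. (\<Sum>k\<in>UNIV. \<alpha> k) \<le> n}"
proof (rule finite_subset)
  have "\<alpha> k \<le> n" if "(\<Sum>k\<in>UNIV. \<alpha> k) \<le> n" for \<alpha> :: "'p multi_index" and k
    using member_le_sum[of k UNIV \<alpha>] that by simp
  then show "{\<alpha> :: 'p multi_index. (\<Sum>k\<in>UNIV. \<alpha> k) \<le> n} \<subseteq> PiE UNIV (\<lambda>k. {..n})"
    by auto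
qed (auto intro: finite_PiE)

text \<open>A function of order at most \<open>n\<close> sees only the finitely many coordinates in
  \<open>C\<close>, so overriding on \<open>C\<close> already gives its full value. As
  \<open>C\<close> is fixed before the curve of jets and the point, one sum formula serves at all
  points.\<close>

lemma jet_chain_rule:
  fixes f :: "('p::finite, 'q::finite) jet_fun" and g :: "'a::real_normed_vector \<Rightarrow> ('p, 'q) jet"
  assumes f: "f \<in> local_funs"
  obtains C where "finite C" "\<And>g g' a. (\<And>c. ((\<lambda>x::'a. g x c) has_derivative g' c) (at a)) \<Longrightarrow>
    ((\<lambda>x. f (g x)) has_derivative (\<lambda>h. \<Sum>c\<in>C. jet_pd c f (g a) * g' c h)) (at a)"
proof -
  obtain n where n: "order_le n f" and sm: "jet_smooth f"
    using f by (auto simp: local_funs_def)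
  define C :: "('p, 'q) jet_coord set" where
    "C = range Indep \<union> (\<lambda>(j, \<alpha>). Dep j \<alpha>) ` (UNIV \<times> {\<alpha>. (\<Sum>k\<in>UNIV. \<alpha> k) \<le> n})"
  have "finite C"
    unfolding C_def by (intro finite_UnI finite_imageI finite_cartesian_product
        finite_multi_indices finite)
  moreover have eq: "f (override_on z w C) = f w" for z w
    by (rule n[unfolded order_le_def, rule_format]) (auto simp: C_def override_on_def)
  have "((\<lambda>x. f (g x)) has_derivative (\<lambda>h. \<Sum>c\<in>C. jet_pd c f (g a) * g' c h)) (at a)"
    if "\<And>c. ((\<lambda>x::'a. g x c) has_derivative g' c) (at a)" for g g' a
    using jet_chain_rule_partial[OF sm \<open>finite C\<close>, of g g' a] that unfolding eq by blast
  ultimately show ?thesis using that by blast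
qed

section \<open>Smoothness of local functions along a smooth field\<close>

lemma smooth_prolong:
  assumes "smooth_vec u"
  shows "smooth (\<lambda>x. prolong u x c)"
  using assms
  by (cases c) (auto simp: prolong_def smooth_vec_def intro: smooth_coord smooth_Dop)

text \<open>By the chain rule a partial derivative is a finite sum of local functions along
  \<open>u\<close> times smooth functions. All local functions serve as generators together, since
  the partial derivatives of \<open>f\<close> on jet space are again local.\<close>

lemma smooth_local_prolong:
  fixes f :: "('p::{finite,linorder}, 'q::finite) jet_fun"
  assumes f: "f \<in> local_funs" and u: "smooth_vec u"
  shows "smooth (\<lambda>x. f (prolong u x))"
proof (rule smooth_alg_imp_smooth)
  let ?S = "(\<lambda>f x. f (prolong u x)) ` local_funs"
  show "(\<lambda>x. f (prolong u x)) \<in> smooth_alg ?S"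
    using f by (intro smooth_alg.base) auto
  fix F assume "F \<in> ?S"
  then obtain f where f: "f \<in> local_funs" and F: "F = (\<lambda>x. f (prolong u x))" by auto
  obtain C where C: "finite C" "\<And>g g' a. (\<And>c. ((\<lambda>x::(real,'p) vec. g x c) has_derivative g' c) (at a)) \<Longrightarrow>
    ((\<lambda>x. f (g x)) has_derivative (\<lambda>h. \<Sum>c\<in>C. jet_pd c f (g a) * g' c h)) (at a)"
    using jet_chain_rule[OF f] by blast
  have "\<forall>c a. \<exists>D. ((\<lambda>x. prolong u x c) has_derivative D) (at a)"
    using smooth_imp_differentiable[OF smooth_prolong[OF u]]
    by (simp add: differentiable_on_def differentiable_def)
  then obtain g' where g': "\<And>c a. ((\<lambda>x. prolong u x c) has_derivative g' c a) (at a)"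
    by metis
  have F': "(F has_derivative (\<lambda>h. \<Sum>c\<in>C. jet_pd c f (prolong u a) * g' c a h)) (at a)" for a
    unfolding F by (rule C(2)) (rule g')
  have "pd k F = (\<lambda>x. \<Sum>c\<in>C. jet_pd c f (prolong u x) * pd k (\<lambda>x. prolong u x c) x)" for k
    by (simp add: pd_eq[OF F'] pd_eq[OF g'] fun_eq_iff)
  moreover have "(\<lambda>x. \<Sum>c\<in>C. jet_pd c f (prolong u x) * pd k (\<lambda>x. prolong u x c) x)
      \<in> smooth_alg ?S" for k
    using C(1)
  proof (induction C rule: finite_induct)
    case empty
    then show ?case by (simp add: smooth_alg.smooth smooth_const)
  next
    case (insert c C)
    have "(\<lambda>x. jet_pd c f (prolong u x) * pd k (\<lambda>x. prolong u x c) x) \<in> smooth_alg ?S"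
      by (intro smooth_alg.mult smooth_alg.base smooth_alg.smooth smooth_pd smooth_prolong u)
        (use local_funs_jet_pd[OF f] in blast)
    with insert show ?case by (simp add: smooth_alg.add)
  qed
  ultimately show "F differentiable_on UNIV \<and> (\<forall>k. pd k F \<in> smooth_alg ?S)"
    using F' by (auto simp: differentiable_on_def differentiable_def)
qed

section \<open>The conservation law\<close>

theorem theorem2p1:
  fixes \<Delta> :: "'l::finite \<Rightarrow> ('p::{finite,linorder}, 'q::finite) jet_fun"
    and \<sigma> :: "'q \<Rightarrow> ('p, 'q) nonlocal_op"
    and \<rho> :: "'l \<Rightarrow> ('p, 'q) nonlocal_op"
  assumes "\<And>i. \<Delta> i \<in> local_funs"
    and "symmetry \<Delta> \<sigma>"
    and "adjoint_symmetry \<Delta> \<rho>"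
  shows "conservation_law \<Delta> (\<lambda>k u x.
    \<Sum>i\<in>UNIV. \<Sum>j\<in>UNIV. Sum_any (\<lambda>\<alpha>. \<Sum>\<beta><\<alpha> k.
      neg_Dop {..<k} \<alpha> ((neg_pd k ^^ \<beta>)
        (\<lambda>y. \<rho> i u y * jet_pd (Dep j \<alpha>) (\<Delta> i) (prolong u y))) x *
      (pd k ^^ (\<alpha> k - \<beta> - 1)) (Dop {k<..} \<alpha> (\<sigma> j u)) x))"
proof -
  obtain n where n: "\<And>i. order_le (n i) (\<Delta> i)"
    using assms(1) unfolding local_funs_def by simp metis
  \<comment> \<open>A finite set containing the support of every sum over \<alpha> that belongs to
    the equation \<open>i\<close>, for all \<open>j\<close> and all points at once.\<close>
  define M where "M i = {\<alpha> :: 'p multi_index. (\<Sum>k\<in>UNIV. \<alpha> k) \<le> n i}" for i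
  have M: "finite (M i)" for i
    unfolding M_def by (rule finite_multi_indices)
  have vanish: "jet_pd (Dep j \<alpha>) (\<Delta> i) z = 0" if "\<alpha> \<notin> M i" for i j \<alpha> z
    by (rule order_le_jet_pd_eq_0[OF n]) (use that in \<open>simp add: M_def\<close>)
  have Sum_any_M: "Sum_any F = sum F (M i)" if "\<And>\<alpha>. \<alpha> \<notin> M i \<Longrightarrow> F \<alpha> = 0"
    for F :: "'p multi_index \<Rightarrow> real" and i
    using that by (intro Sum_any.expand_superset M) auto
  define A where "A u i j \<alpha> y = \<rho> i u y * jet_pd (Dep j \<alpha>) (\<Delta> i) (prolong u y)" for u i j \<alpha> y
  define Q where "Q k u i j \<alpha> \<beta> x = neg_Dop {..<k} \<alpha> ((neg_pd k ^^ \<beta>) (A u i j \<alpha>)) x *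
      (pd k ^^ (\<alpha> k - \<beta> - 1)) (Dop {k<..} \<alpha> (\<sigma> j u)) x" for k u i j \<alpha> \<beta> x
  \<comment> \<open>Outside \<open>M i\<close> the coefficient is zero as a function, not just at
    one point, so the operators applied to it give zero as well.\<close>
  have A0: "A u i j \<alpha> = (\<lambda>y. 0)" if "\<alpha> \<notin> M i" for u i j \<alpha>
    using vanish[OF that] by (simp add: A_def fun_eq_iff)
  have Q_sum: "Sum_any (\<lambda>\<alpha>. \<Sum>\<beta><\<alpha> k. Q k u i j \<alpha> \<beta> x) = (\<Sum>\<alpha>\<in>M i. \<Sum>\<beta><\<alpha> k. Q k u i j \<alpha> \<beta> x)"
    for k u i j x
    by (rule Sum_any_M) (simp add: Q_def A0)
  have sm_\<sigma>: "smooth (\<sigma> j u)" and sm_\<rho>: "smooth (\<rho> i u)" if "smooth_vec u" for u i j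
    using assms(2,3) that by (auto simp: symmetry_def adjoint_symmetry_def nonlocal_funs_def)
  have sm_A: "smooth (A u i j \<alpha>)" if "smooth_vec u" for u i j \<alpha>
    unfolding A_def[abs_def]
    by (intro smooth_mult sm_\<rho> smooth_local_prolong local_funs_jet_pd assms(1) that)
  have sm_Q: "smooth (Q k u i j \<alpha> \<beta>)" if "smooth_vec u" for k u i j \<alpha> \<beta>
    unfolding Q_def[abs_def]
    by (intro smooth_mult smooth_neg_Dop smooth_neg_pd_funpow smooth_pd_funpow smooth_Dop
        sm_A sm_\<sigma> that)
  have "conservation_law \<Delta> (\<lambda>k u x. \<Sum>i\<in>UNIV. \<Sum>j\<in>UNIV. \<Sum>\<alpha>\<in>M i. \<Sum>\<beta><\<alpha> k. Q k u i j \<alpha> \<beta> x)"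
    unfolding conservation_law_def
  proof (intro conjI allI impI)
    fix k
    show "(\<lambda>u x. \<Sum>i\<in>UNIV. \<Sum>j\<in>UNIV. \<Sum>\<alpha>\<in>M i. \<Sum>\<beta><\<alpha> k. Q k u i j \<alpha> \<beta> x) \<in> nonlocal_funs"
      unfolding nonlocal_funs_def by (auto intro!: smooth_sum sm_Q)
  next
    fix u x
    assume sol: "solution \<Delta> u"
    then have u: "smooth_vec u" by (simp add: solution_def)
    have "(\<Sum>k\<in>UNIV. pd k (\<lambda>x. \<Sum>i\<in>UNIV. \<Sum>j\<in>UNIV. \<Sum>\<alpha>\<in>M i. \<Sum>\<beta><\<alpha> k. Q k u i j \<alpha> \<beta> x) x)
        = (\<Sum>k\<in>UNIV. \<Sum>i\<in>UNIV. \<Sum>j\<in>UNIV. \<Sum>\<alpha>\<in>M i. \<Sum>\<beta><\<alpha> k. pd k (Q k u i j \<alpha> \<beta>) x)"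
      by (simp add: pd_sum smooth_sum sm_Q[OF u])
    \<comment> \<open>The sum over \<open>k\<close> moves inside the other three, so that Lagrange's
      identity applies to each triple \<open>(i, j, \<alpha>)\<close> separately.\<close>
    also have "\<dots> = (\<Sum>i\<in>UNIV. \<Sum>j\<in>UNIV. \<Sum>\<alpha>\<in>M i. \<Sum>k\<in>UNIV. \<Sum>\<beta><\<alpha> k. pd k (Q k u i j \<alpha> \<beta>) x)"
      by (subst sum.swap, intro sum.cong refl, subst sum.swap, intro sum.cong refl, rule sum.swap)
    also have "\<dots> = (\<Sum>i\<in>UNIV. \<Sum>j\<in>UNIV. \<Sum>\<alpha>\<in>M i.
        A u i j \<alpha> x * Dop UNIV \<alpha> (\<sigma> j u) x - neg_Dop UNIV \<alpha> (A u i j \<alpha>) x * \<sigma> j u x)"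
      unfolding Q_def[abs_def]
      by (intro sum.cong refl divergence_eq sm_A[OF u] sm_\<sigma>[OF u])
    also have "\<dots> = (\<Sum>i\<in>UNIV. \<Sum>j\<in>UNIV. \<Sum>\<alpha>\<in>M i. A u i j \<alpha> x * Dop UNIV \<alpha> (\<sigma> j u) x)
        - (\<Sum>i\<in>UNIV. \<Sum>j\<in>UNIV. \<Sum>\<alpha>\<in>M i. neg_Dop UNIV \<alpha> (A u i j \<alpha>) x * \<sigma> j u x)"
      by (simp add: sum_subtractf)
    \<comment> \<open>Here \<rho> is an undifferentiated factor and comes out of the sums over
      \<open>j\<close> and \<alpha>, leaving the Gateaux operator applied to \<sigma>.\<close>
    also have "(\<Sum>i\<in>UNIV. \<Sum>j\<in>UNIV. \<Sum>\<alpha>\<in>M i. A u i j \<alpha> x * Dop UNIV \<alpha> (\<sigma> j u) x)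
        = (\<Sum>i\<in>UNIV. \<rho> i u x * gateaux \<Delta> u (\<lambda>j. \<sigma> j u) i x)"
    proof (rule sum.cong[OF refl])
      fix i
      have "Sum_any (\<lambda>\<alpha>. jet_pd (Dep j \<alpha>) (\<Delta> i) (prolong u x) * Dop UNIV \<alpha> (\<sigma> j u) x)
          = (\<Sum>\<alpha>\<in>M i. jet_pd (Dep j \<alpha>) (\<Delta> i) (prolong u x) * Dop UNIV \<alpha> (\<sigma> j u) x)" for j
        by (rule Sum_any_M) (simp add: vanish)
      then show "(\<Sum>j\<in>UNIV. \<Sum>\<alpha>\<in>M i. A u i j \<alpha> x * Dop UNIV \<alpha> (\<sigma> j u) x)
          = \<rho> i u x * gateaux \<Delta> u (\<lambda>j. \<sigma> j u) i x"
        by (simp add: gateaux_def A_def sum_distrib_left mult.assoc)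
    qed
    \<comment> \<open>With \<open>j\<close> outermost, the undifferentiated \<sigma> comes out and
      the inner sums form the adjoint operator applied to \<rho>.\<close>
    also have "(\<Sum>i\<in>UNIV. \<Sum>j\<in>UNIV. \<Sum>\<alpha>\<in>M i. neg_Dop UNIV \<alpha> (A u i j \<alpha>) x * \<sigma> j u x)
        = (\<Sum>j\<in>UNIV. \<Sum>i\<in>UNIV. \<Sum>\<alpha>\<in>M i. neg_Dop UNIV \<alpha> (A u i j \<alpha>) x * \<sigma> j u x)"
      by (rule sum.swap)
    also have "\<dots> = (\<Sum>j\<in>UNIV. gateaux_adjoint \<Delta> u (\<lambda>i. \<rho> i u) j x * \<sigma> j u x)"
    proof (rule sum.cong[OF refl])
      fix j
      have "Sum_any (\<lambda>\<alpha>. neg_Dop UNIV \<alpha> (\<lambda>y. jet_pd (Dep j \<alpha>) (\<Delta> i) (prolong u y) * \<rho> i u y) x)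
          = (\<Sum>\<alpha>\<in>M i. neg_Dop UNIV \<alpha> (A u i j \<alpha>) x)" for i
        by (subst Sum_any_M) (simp_all add: vanish A_def[abs_def] mult.commute)
      then show "(\<Sum>i\<in>UNIV. \<Sum>\<alpha>\<in>M i. neg_Dop UNIV \<alpha> (A u i j \<alpha>) x * \<sigma> j u x)
          = gateaux_adjoint \<Delta> u (\<lambda>i. \<rho> i u) j x * \<sigma> j u x"
        by (simp add: gateaux_adjoint_def sum_distrib_right)
    qed
    also have "(\<Sum>i\<in>UNIV. \<rho> i u x * gateaux \<Delta> u (\<lambda>j. \<sigma> j u) i x)
        - (\<Sum>j\<in>UNIV. gateaux_adjoint \<Delta> u (\<lambda>i. \<rho> i u) j x * \<sigma> j u x) = 0"
      using assms(2,3) sol by (simp add: symmetry_def adjoint_symmetry_def)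
    finally show "(\<Sum>k\<in>UNIV. pd k (\<lambda>x. \<Sum>i\<in>UNIV. \<Sum>j\<in>UNIV. \<Sum>\<alpha>\<in>M i. \<Sum>\<beta><\<alpha> k. Q k u i j \<alpha> \<beta> x) x) = 0" .
  qed
  \<comment> \<open>The finite sums are turned back into \<open>Sum_any\<close> while
    \<open>Q\<close> is still folded; only then are the abbreviations expanded.\<close>
  then show ?thesis
    unfolding Q_sum[symmetric] unfolding Q_def A_def[abs_def] .
qed

end
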